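(* For every integer $r\ge 0$, $$\sum_{n=0}^{\infty} d_{r,n}^{B}\,\frac{x^{n}}{n!}=\frac{e^{-x}}{1-2x}\left(\frac{1+2x}{1-2x}\right)^{r}$$ as formal power series.
   Context: A signed permutation (permutation of type $B$) of $[N]=\{1,\dots,N\}$ is a bijection $\sigma$ of $\{1,\dots,N\}\cup\{\overline 1,\dots,\overline N\}$ with $\sigma(\overline j)=\overline{\sigma(j)}$ (where $\overline{\overline j}=j$). The cycles of $\sigma$ are the cycles of the permutation $|\sigma|$ of $[N]$ obtained by forgetting the bars. For integers $n,r\ge 0$, $d_{r,n}^{B}$ denotes the number of $r$-derangements of type $B$ on $[n+r]$, that is, of signed permutations $\sigma$ of $[n+r]$ such that $\sigma(i)\ne i$ for all $i\in[n+r]$ ($\sigma(i)=\overline i$ is allowed) and such that the $r$ special elements $1,\dots,r$ lie in distinct cycles. *)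

theory Defs
  imports "HOL-Combinatorics.Combinatorics" "HOL-Computational_Algebra.Formal_Power_Series"
begin

(* The barred element j-bar is encoded as the negative integer -j. *)
definition signed_set :: "nat \<Rightarrow> int set" where
  "signed_set N = {1..int N} \<union> uminus ` {1..int N}"

(* "permutes" makes a signed permutation the identity outside signed_set N, so that
   distinct functions represent distinct bijections of signed_set N. *)
definition signed_permutations :: "nat \<Rightarrow> (int \<Rightarrow> int) set" where
  "signed_permutations N =
     {\<sigma>. \<sigma> permutes signed_set N \<and> (\<forall>j\<in>signed_set N. \<sigma> (- j) = - \<sigma> j)}"

(* Forgetting the bars of a signed permutation of {1..N} gives a permutation of {1..N}
   that is the identity outside {1..N}. *)
definition unsigned_perm :: "(int \<Rightarrow> int) \<Rightarrow> nat \<Rightarrow> nat" where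
  "unsigned_perm \<sigma> i = nat \<bar>\<sigma> (int i)\<bar>"

(* The cycle containing i is the orbit of i, so the special elements 1, ..., r lie in
   distinct cycles iff taking orbits is injective on {1..r}. *)
definition r_derangements_B :: "nat \<Rightarrow> nat \<Rightarrow> (int \<Rightarrow> int) set" where
  "r_derangements_B r n =
     {\<sigma> \<in> signed_permutations (n + r).
        (\<forall>i\<in>{1..n + r}. \<sigma> (int i) \<noteq> int i) \<and>
        inj_on (orbit (unsigned_perm \<sigma>)) {1..r}}"

definition dB :: "nat \<Rightarrow> nat \<Rightarrow> nat" where
  "dB r n = card (r_derangements_B r n)"

end

theory Submission
  imports Defs
begin

text \<open>
  A signed permutation of \<open>[N]\<close> is a permutation \<open>p\<close> of \<open>[N]\<close> together with the set \<open>T\<close> of those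
  \<open>i\<close> whose image carries a bar. It has no fixed point exactly when \<open>T\<close> contains every fixed point
  of \<open>p\<close>. Each fixed point thus has one admissible sign and every other element has two, and
  writing the factor \<open>1\<close> of a fixed point as \<open>2 - 1\<close> turns the number of admissible sets \<open>T\<close> into
  an alternating sum over sets \<open>F\<close> of fixed points (\<open>card_supersets_within\<close>).

  Exchanging the two summations leaves, for each \<open>F\<close>, the number of permutations that fix \<open>F\<close>
  pointwise and keep the special elements in distinct cycles. A fixed special element is alone in
  its cycle, so \<open>F\<close> can simply be deleted (\<open>separating_perms_fixing\<close>). The remaining count is the
  quotient of factorials \<open>m! / s!\<close> for \<open>m\<close> elements of which \<open>s\<close> are special
  (\<open>card_separating_perms\<close>): starting from the identity on the special elements, insert the other
  elements one after the other, each time either just before one of the elements already present or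
  as a new cycle. No insertion merges two cycles.

  Splitting \<open>F\<close> into \<open>j\<close> special and \<open>k\<close> ordinary elements gives an explicit double sum for
  \<open>dB r n\<close> (\<open>dB_eq_double_sum\<close>). After division by \<open>n!\<close> its inner sum is the convolution of the
  coefficients of \<open>exp (-x)\<close> with those of \<open>1 / (1 - 2x) ^ (r - j + 1)\<close>, and the outer sum is the
  binomial expansion of \<open>((1 + 2x) / (1 - 2x)) ^ r\<close> written as \<open>(2 / (1 - 2x) - 1) ^ r\<close>.
\<close>

section \<open>Permutations separating a set of special elements\<close>

definition separating_perms :: "'a set \<Rightarrow> 'a set \<Rightarrow> ('a \<Rightarrow> 'a) set" where
  "separating_perms A S = {p. p permutes A \<and> inj_on (orbit p) S}"

lemma finite_separating_perms: "finite A \<Longrightarrow> finite (separating_perms A S)"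
  unfolding separating_perms_def by (rule finite_subset[OF _ finite_permutations]) auto

lemma permutes_self_in_orbit:
  assumes "finite A" "p permutes A"
  shows "x \<in> orbit p x"
  using assms by (intro permutation_self_in_orbit) (auto simp: permutation_permutes)

lemma orbit_fixed_point:
  assumes "p x = x"
  shows "orbit p x = {x}"
proof -
  have "y = x" if "y \<in> orbit p x" for y
    using that by induct (auto simp: assms)
  then show ?thesis using orbit_nonempty[of p x] by blast
qed

text \<open>
  Composing \<open>q\<close> with \<open>transpose a b\<close> inserts \<open>a\<close> into the cycle of \<open>b\<close>, just before \<open>b\<close>: the
  preimage of \<open>b\<close> is now sent to \<open>a\<close>, and \<open>a\<close> to \<open>b\<close>. For \<open>b = a\<close> it leaves \<open>a\<close> as a cycle of
  its own. In both cases the old cycles are unchanged apart from the new element.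
\<close>

lemma orbit_insert_element:
  assumes "finite A" "q permutes A" "a \<notin> A" "b \<in> insert a A" "x \<in> A"
  shows "orbit (transpose a b \<circ> q) x - {a} = orbit q x"
proof (cases "b = a")
  case True
  have "y \<in> A" if "y \<in> orbit q x" for y
    using that assms by induct (auto simp: permutes_in_image)
  then show ?thesis using True assms(3) by auto
next
  case False
  define p where "p = transpose a b \<circ> q"
  have b: "b \<in> A" using False assms(4) by auto
  have qa: "q a = a" using assms by (simp add: permutes_not_in)
  have qA: "q z \<in> A" "q z \<noteq> a" if "z \<in> A" for z
    using that permutes_in_image[OF assms(2), of z] assms(3) by auto
  have pa: "p a = b" by (simp add: p_def qa)
  have p_eq: "p z = (if q z = b then a else q z)" if "z \<in> A" for z
    using qA[OF that] by (auto simp: p_def transpose_def)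
  have sub: "y \<in> A" if "y \<in> orbit q x" for y
    using that by induct (auto simp: assms(5) qA)
  \<comment> \<open>A walk along the new cycle may stop at \<open>a\<close>, where the old cycle has no counterpart; the
    invariant then records that the next element \<open>b\<close> lies on the old cycle.\<close>
  have 1: "(y \<noteq> a \<longrightarrow> y \<in> orbit q x) \<and> (y = a \<longrightarrow> b \<in> orbit q x)" if "y \<in> orbit p x" for y
    using that
  proof induct
    case base
    show ?case
      using p_eq[OF assms(5)] qA[OF assms(5)] orbit.base[of q x] by auto
  next
    case (step y)
    show ?case
    proof (cases "y = a")
      case True
      then show ?thesis using step pa False by simp
    next
      case neq: False
      then have y: "y \<in> orbit q x" using step by simp
      then have "q y \<in> orbit q x" by (rule orbit.step)
      then show ?thesis using p_eq[OF sub[OF y]] qA(2)[OF sub[OF y]] by auto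
    qed
  qed
  \<comment> \<open>One step of \<open>q\<close> is one step of the new permutation, or two with a stop at \<open>a\<close>.\<close>
  have reach: "q z \<in> orbit p x" if "z \<in> A" "p z \<in> orbit p x" for z
    using that p_eq[OF that(1)] pa orbit.step[of a p x] by (auto split: if_splits)
  have 2: "y \<in> orbit p x" if "y \<in> orbit q x" for y
    using that
  proof induct
    case base
    show ?case by (rule reach[OF assms(5) orbit.base])
  next
    case (step y)
    then show ?case by (intro reach[OF sub] orbit.step)
  qed
  show ?thesis
    using 1 2 sub assms(3) unfolding p_def[symmetric] by blast
qed

lemma inj_on_orbit_insert_element:
  assumes "finite A" "q permutes A" "a \<notin> A" "b \<in> insert a A" "S \<subseteq> A"
  shows "inj_on (orbit (transpose a b \<circ> q)) S \<longleftrightarrow> inj_on (orbit q) S"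
proof -
  define p where "p = transpose a b \<circ> q"
  have p: "p permutes insert a A"
    unfolding p_def using assms
    by (intro permutes_compose[of q] permutes_swap_id) (auto intro: permutes_subset)
  have fin: "finite (insert a A)" using assms by simp
  have *: "orbit p x - {a} = orbit q x" if "x \<in> S" for x
    unfolding p_def using assms that by (intro orbit_insert_element[of A]) auto
  have "orbit p x = orbit p y \<longleftrightarrow> orbit q x = orbit q y" if "x \<in> S" "y \<in> S" for x y
  proof
    assume "orbit p x = orbit p y"
    then show "orbit q x = orbit q y" using *[OF that(1)] *[OF that(2)] by simp
  next
    assume "orbit q x = orbit q y"
    then have "x \<in> orbit q y"
      using permutes_self_in_orbit[OF assms(1,2), of x] by simp
    then have "x \<in> orbit p y" using *[OF that(2)] by blast
    then show "orbit p x = orbit p y"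
      using orbit_swap[OF permutes_self_in_orbit[OF fin p], of x y] by (auto intro: orbit_trans)
  qed
  then show ?thesis unfolding p_def[symmetric] inj_on_def by blast
qed

text \<open>
  The position \<open>b\<close> at which a non-special element \<open>a\<close> is inserted is arbitrary, since insertion
  affects neither way whether the special elements are separated; hence the factor
  \<open>Suc (card A)\<close>.
\<close>

lemma card_separating_perms_insert:
  assumes "finite A" "a \<notin> A" "S \<subseteq> A"
  shows "card (separating_perms (insert a A) S) = Suc (card A) * card (separating_perms A S)"
proof -
  let ?g = "\<lambda>(b, p). transpose a b \<circ> p"
  have "separating_perms (insert a A) S = ?g ` (insert a A \<times> separating_perms A S)"
    (is "?L = ?R")
  proof
    show "?L \<subseteq> ?R"
    proof
      fix p assume p: "p \<in> ?L"
      then have "p \<in> ?g ` {(b, q). b \<in> insert a A \<and> q \<in> {q. q permutes A}}"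
        unfolding permutes_insert[symmetric] by (simp add: separating_perms_def)
      then obtain b q where bq: "b \<in> insert a A" "q permutes A" "p = transpose a b \<circ> q" by auto
      then have "q \<in> separating_perms A S"
        using p inj_on_orbit_insert_element[OF assms(1) bq(2) assms(2) bq(1) assms(3)]
        by (simp add: separating_perms_def)
      then show "p \<in> ?R" using bq by auto
    qed
    show "?R \<subseteq> ?L"
    proof clarify
      fix b q assume bq: "b \<in> insert a A" "q \<in> separating_perms A S"
      then have q: "q permutes A" by (simp add: separating_perms_def)
      then have "transpose a b \<circ> q \<in> {p. p permutes insert a A}"
        using bq(1) unfolding permutes_insert by auto
      then show "transpose a b \<circ> q \<in> ?L"
        using bq inj_on_orbit_insert_element[OF assms(1) q assms(2) bq(1) assms(3)]
        by (simp add: separating_perms_def)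
    qed
  qed
  moreover have "inj_on ?g (insert a A \<times> separating_perms A S)"
  proof (rule inj_onI, clarify)
    fix b q c q'
    assume q: "q \<in> separating_perms A S" and q': "q' \<in> separating_perms A S"
      and eq: "transpose a b \<circ> q = transpose a c \<circ> q'"
    \<comment> \<open>The position can be read off as the image of \<open>a\<close>.\<close>
    have "q a = a" "q' a = a"
      using q q' assms(2) by (auto simp: separating_perms_def permutes_not_in)
    then have "b = c" using fun_cong[OF eq, of a] by simp
    moreover from this have "q = q'"
      using arg_cong[OF eq, of "\<lambda>f. transpose a b \<circ> f"] by (simp add: comp_assoc[symmetric])
    ultimately show "b = c \<and> q = q'" by simp
  qed
  ultimately show ?thesis
    using assms by (simp add: card_image card_cartesian_product)
qed

lemma separating_perms_self:
  assumes "finite A"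
  shows "separating_perms A A = {id}"
proof -
  have "p = id" if p: "p permutes A" and inj: "inj_on (orbit p) A" for p
  proof
    fix x
    have "orbit p (p x) = orbit p x"
      using assms p by (intro permutation_orbit_step) (auto simp: permutation_permutes)
    then show "p x = id x"
      using inj p by (cases "x \<in> A") (auto simp: inj_on_def permutes_in_image permutes_not_in)
  qed
  moreover have "inj_on (orbit id) A"
    by (simp add: orbit_fixed_point inj_on_def)
  ultimately show ?thesis
    unfolding separating_perms_def by auto
qed

text \<open>
  Only the identity separates all elements of \<open>S\<close> when nothing else is present; inserting the
  elements of \<open>A - S\<close> then contributes the factors \<open>card S + 1, \<dots>, card A\<close> in turn.
\<close>

lemma card_separating_perms:
  assumes "finite A" "S \<subseteq> A"
  shows "card (separating_perms A S) * fact (card S) = fact (card A)"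
proof -
  have "card (separating_perms (S \<union> B) S) * fact (card S) = fact (card (S \<union> B))"
    if "finite B" "B \<inter> S = {}" for B
    using that
  proof (induction B)
    case empty
    then show ?case using assms by (simp add: separating_perms_self finite_subset)
  next
    case (insert b B)
    have "finite (S \<union> B)" "b \<notin> S \<union> B"
      using insert assms finite_subset by auto
    then show ?case
      using insert by (simp add: card_separating_perms_insert mult.assoc del: mult_Suc)
  qed
  from this[of "A - S"] show ?thesis
    using assms by (simp add: Un_absorb1 Int_commute)
qed

text \<open>
  The orbit of a fixed point is a singleton, so it differs from the orbits of all other elements
  and imposes no condition on the special elements.
\<close>

lemma separating_perms_fixing:
  assumes "finite A" "F \<subseteq> A"
  shows "{p \<in> separating_perms A S. \<forall>i\<in>F. p i = i} = separating_perms (A - F) (S - F)"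
proof -
  have "p permutes A \<and> (\<forall>i\<in>F. p i = i) \<longleftrightarrow> p permutes (A - F)" for p
    using assms(2) by (auto intro: permutes_superset permutes_subset simp: permutes_not_in)
  moreover have "inj_on (orbit p) S" if p: "p permutes (A - F)" and inj: "inj_on (orbit p) (S - F)" for p
  proof (rule inj_onI)
    fix x y assume xy: "x \<in> S" "y \<in> S" "orbit p x = orbit p y"
    have self: "z \<in> orbit p z" for z
      using assms(1) by (intro permutes_self_in_orbit[OF _ p]) simp
    have singleton: "orbit p z = {z}" if "z \<in> F" for z
      using p that by (intro orbit_fixed_point) (simp add: permutes_not_in)
    show "x = y"
    proof (cases "x \<in> F \<or> y \<in> F")
      case True
      have "y \<in> orbit p x" unfolding xy(3) by (rule self)
      moreover have "x \<in> orbit p y" unfolding xy(3)[symmetric] by (rule self)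
      ultimately show ?thesis using True singleton by (metis singletonD)
    next
      case False
      then show ?thesis using inj xy by (auto simp: inj_on_def)
    qed
  qed
  moreover have "inj_on f (S - F)" if "inj_on f S" for f :: "'a \<Rightarrow> 'a set"
    using that by (rule inj_on_subset) auto
  ultimately show ?thesis
    unfolding separating_perms_def by blast
qed

section \<open>Signed permutations as permutations with a set of barred positions\<close>

lemma mem_signed_set: "j \<in> signed_set N \<longleftrightarrow> nat \<bar>j\<bar> \<in> {1..N}"
proof -
  have "j \<in> uminus ` {1..int N} \<longleftrightarrow> - j \<in> {1..int N}"
    by (metis (no_types, lifting) image_iff minus_minus)
  then show ?thesis unfolding signed_set_def by auto
qed

lemma finite_signed_set: "finite (signed_set N)"
  by (simp add: signed_set_def)

text \<open>
  The factor \<open>sgn j\<close> makes the function odd; it also gives the value \<open>0\<close> at \<open>0\<close>, and the identity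
  outside the signed set as soon as \<open>p\<close> is the identity and \<open>T\<close> is empty there.
\<close>

definition sign_perm :: "(nat \<Rightarrow> nat) \<Rightarrow> nat set \<Rightarrow> int \<Rightarrow> int" where
  "sign_perm p T j = sgn j * (if nat \<bar>j\<bar> \<in> T then - 1 else 1) * int (p (nat \<bar>j\<bar>))"

lemma abs_sign_perm: "p 0 = 0 \<Longrightarrow> nat \<bar>sign_perm p T j\<bar> = p (nat \<bar>j\<bar>)"
  by (auto simp: sign_perm_def abs_mult abs_sgn_eq)

lemma unsigned_sign_perm:
  assumes "p permutes {1..N}"
  shows "unsigned_perm (sign_perm p T) = p"
proof -
  have "p 0 = 0" using assms by (simp add: permutes_not_in)
  then show ?thesis by (simp add: fun_eq_iff unsigned_perm_def abs_sign_perm)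
qed

lemma sign_perm_signed:
  assumes p: "p permutes {1..N}" and T: "T \<subseteq> {1..N}"
  shows "sign_perm p T \<in> signed_permutations N"
proof -
  have p0: "p 0 = 0" using p by (simp add: permutes_not_in)
  have "sign_perm p T permutes signed_set N"
  proof (rule inj_imp_permutes)
    show "finite (signed_set N)" by (rule finite_signed_set)
    show "sign_perm p T j \<in> signed_set N" if "j \<in> signed_set N" for j
      using that permutes_in_image[OF p] unfolding mem_signed_set abs_sign_perm[of p, OF p0] by blast
    show "sign_perm p T j = j" if "j \<notin> signed_set N" for j
    proof -
      have "p (nat \<bar>j\<bar>) = nat \<bar>j\<bar>" "nat \<bar>j\<bar> \<notin> T"
        using that p T by (auto simp: mem_signed_set permutes_not_in)
      then show ?thesis by (simp add: sign_perm_def mult_sgn_abs)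
    qed
    show "inj_on (sign_perm p T) (signed_set N)"
    proof (rule inj_onI)
      fix i j assume ij: "i \<in> signed_set N" "j \<in> signed_set N" "sign_perm p T i = sign_perm p T j"
      have "p (nat \<bar>i\<bar>) = p (nat \<bar>j\<bar>)"
        using abs_sign_perm[of p, OF p0] ij(3) by metis
      then have eq: "nat \<bar>i\<bar> = nat \<bar>j\<bar>" using permutes_inj[OF p] by (simp add: inj_eq)
      moreover have "p (nat \<bar>j\<bar>) \<noteq> 0"
        using permutes_in_image[OF p, of "nat \<bar>j\<bar>"] ij(2) by (auto simp: mem_signed_set)
      ultimately have "sgn i = sgn j" using ij(3) by (simp add: sign_perm_def split: if_splits)
      moreover have "\<bar>i\<bar> = \<bar>j\<bar>" using eq by simp
      ultimately show "i = j" by (metis mult_sgn_abs)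
    qed
  qed
  moreover have "sign_perm p T (- j) = - sign_perm p T j" for j
    by (simp add: sign_perm_def)
  ultimately show ?thesis by (simp add: signed_permutations_def)
qed

lemma signed_permutation_minus:
  assumes "\<sigma> \<in> signed_permutations N"
  shows "\<sigma> (- j) = - \<sigma> j"
proof (cases "j \<in> signed_set N")
  case True
  then show ?thesis using assms unfolding signed_permutations_def by blast
next
  case False
  have "\<sigma> permutes signed_set N" using assms unfolding signed_permutations_def by blast
  moreover have "- j \<notin> signed_set N" using False by (simp add: mem_signed_set)
  ultimately show ?thesis using False by (simp add: permutes_not_in)
qed

lemma unsigned_perm_permutes:
  assumes "\<sigma> \<in> signed_permutations N"
  shows "unsigned_perm \<sigma> permutes {1..N}"
proof (rule inj_imp_permutes)
  have \<sigma>: "\<sigma> permutes signed_set N" using assms by (simp add: signed_permutations_def)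
  show "inj_on (unsigned_perm \<sigma>) {1..N}"
  proof (rule inj_onI)
    fix i j assume "unsigned_perm \<sigma> i = unsigned_perm \<sigma> j"
    then have "\<bar>\<sigma> (int i)\<bar> = \<bar>\<sigma> (int j)\<bar>" by (simp add: unsigned_perm_def)
    then have "\<sigma> (int i) = \<sigma> (int j) \<or> \<sigma> (int i) = \<sigma> (- int j)"
      using signed_permutation_minus[OF assms] by (auto simp: abs_eq_iff)
    then have "int i = int j \<or> int i = - int j"
      using permutes_inj[OF \<sigma>] by (simp add: inj_eq)
    then show "i = j" by auto
  qed
  show "unsigned_perm \<sigma> i \<in> {1..N}" if "i \<in> {1..N}" for i
    using that permutes_in_image[OF \<sigma>, of "int i"] by (simp add: mem_signed_set unsigned_perm_def)
  show "unsigned_perm \<sigma> i = i" if "i \<notin> {1..N}" for i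
  proof -
    have "int i \<notin> signed_set N" using that by (simp add: mem_signed_set)
    then show ?thesis using \<sigma> by (simp add: unsigned_perm_def permutes_not_in)
  qed
qed simp

lemma sign_perm_unsigned:
  assumes "\<sigma> \<in> signed_permutations N"
  shows "sign_perm (unsigned_perm \<sigma>) {i \<in> {1..N}. \<sigma> (int i) < 0} = \<sigma>"
proof
  fix j
  have \<sigma>: "\<sigma> permutes signed_set N" using assms by (simp add: signed_permutations_def)
  have minus: "\<sigma> (- j) = - \<sigma> j" by (rule signed_permutation_minus[OF assms])
  show "sign_perm (unsigned_perm \<sigma>) {i \<in> {1..N}. \<sigma> (int i) < 0} j = \<sigma> j"
  proof (cases "j \<in> signed_set N")
    case True
    then have "nat \<bar>j\<bar> \<in> {1..N}" "j \<noteq> 0" by (auto simp: mem_signed_set)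
    then show ?thesis
      using minus by (cases "j > 0") (auto simp: sign_perm_def unsigned_perm_def)
  next
    case False
    then have "nat \<bar>j\<bar> \<notin> {1..N}" "int (nat \<bar>j\<bar>) \<notin> signed_set N"
      by (auto simp: mem_signed_set)
    then have "sign_perm (unsigned_perm \<sigma>) {i \<in> {1..N}. \<sigma> (int i) < 0} j = sgn j * \<bar>j\<bar>"
      using permutes_not_in[OF \<sigma>, of "\<bar>j\<bar>"] by (auto simp: sign_perm_def unsigned_perm_def)
    then show ?thesis using False permutes_not_in[OF \<sigma>] by (simp add: mult_sgn_abs)
  qed
qed

text \<open>
  A signed permutation either fixes a fixed point of its unsigned permutation \<open>p\<close> or sends it to
  its own bar. Only the second is allowed in a derangement, so the fixed points of \<open>p\<close> have to
  lie in \<open>T\<close> and all other signs are free.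
\<close>

lemma bij_betw_r_derangements_B:
  "bij_betw (\<lambda>(p, T). sign_perm p T)
     (SIGMA p:separating_perms {1..n + r} {1..r}. {T. {i \<in> {1..n + r}. p i = i} \<subseteq> T \<and> T \<subseteq> {1..n + r}})
     (r_derangements_B r n)"
    (is "bij_betw ?f ?P ?D")
proof (rule bij_betw_byWitness[where f' = "\<lambda>\<sigma>. (unsigned_perm \<sigma>, {i \<in> {1..n + r}. \<sigma> (int i) < 0})"])
  let ?N = "n + r"
  let ?g = "\<lambda>\<sigma>. (unsigned_perm \<sigma>, {i \<in> {1..?N}. \<sigma> (int i) < 0})"
  have "?g (sign_perm p T) = (p, T)" if "p permutes {1..?N}" "T \<subseteq> {1..?N}" for p T
  proof -
    have "sign_perm p T (int i) < 0 \<longleftrightarrow> i \<in> T" if "i \<in> {1..?N}" for i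
      using permutes_in_image[OF \<open>p permutes {1..?N}\<close>, of i] that
      by (auto simp: sign_perm_def)
    then have "{i \<in> {1..?N}. sign_perm p T (int i) < 0} = T"
      using \<open>T \<subseteq> {1..?N}\<close> by auto
    then show ?thesis using unsigned_sign_perm that by simp
  qed
  then show "\<forall>x\<in>?P. ?g (?f x) = x"
    by (auto simp: separating_perms_def)
  show "\<forall>\<sigma>\<in>?D. ?f (?g \<sigma>) = \<sigma>"
    using sign_perm_unsigned by (auto simp: r_derangements_B_def)
  show "?f ` ?P \<subseteq> ?D"
  proof clarify
    fix p T assume p: "p \<in> separating_perms {1..?N} {1..r}"
      and fixed: "{i \<in> {1..?N}. p i = i} \<subseteq> T" and T: "T \<subseteq> {1..?N}"
    then have perm: "p permutes {1..?N}" by (simp add: separating_perms_def)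
    have "sign_perm p T (int i) \<noteq> int i" if "i \<in> {1..?N}" for i
    proof
      assume eq: "sign_perm p T (int i) = int i"
      have "p i = i" using eq unsigned_sign_perm[OF perm, of T] by (metis abs_of_nat nat_int unsigned_perm_def)
      moreover from this have "i \<in> T" using fixed that by blast
      ultimately show False using eq that by (simp add: sign_perm_def)
    qed
    then show "sign_perm p T \<in> ?D"
      using p sign_perm_signed[OF perm T]
      by (auto simp: r_derangements_B_def unsigned_sign_perm[OF perm] separating_perms_def)
  qed
  show "?g ` ?D \<subseteq> ?P"
  proof (rule image_subsetI)
    fix \<sigma> assume \<sigma>: "\<sigma> \<in> ?D"
    then have signed: "\<sigma> \<in> signed_permutations ?N" by (simp add: r_derangements_B_def)
    have "\<sigma> (int i) < 0" if "i \<in> {1..?N}" "unsigned_perm \<sigma> i = i" for i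
    proof -
      have "\<bar>\<sigma> (int i)\<bar> = int i" using that(2) by (simp add: unsigned_perm_def)
      moreover have "\<sigma> (int i) \<noteq> int i" using \<sigma> that(1) by (simp add: r_derangements_B_def)
      ultimately show ?thesis by linarith
    qed
    then show "?g \<sigma> \<in> ?P"
      using \<sigma> unsigned_perm_permutes[OF signed]
      by (auto simp: r_derangements_B_def separating_perms_def)
  qed
qed

section \<open>Inclusion-exclusion over fixed points\<close>

text \<open>
  Both sides equal \<open>2 ^ card (A - X)\<close>; the right-hand side is the expansion of a product with
  a factor \<open>-1 + 2\<close> for each element of \<open>X\<close> and a factor \<open>2\<close> for each element of \<open>A - X\<close>. This
  form makes the dependence on \<open>X\<close> summable over all permutations with a prescribed set of fixed
  points.
\<close>

lemma card_supersets_within: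
  assumes "finite A" "X \<subseteq> A"
  shows "real (card {T. X \<subseteq> T \<and> T \<subseteq> A}) = (\<Sum>F\<in>Pow X. (- 1) ^ card F * 2 ^ card (A - F))"
proof -
  have finX: "finite X" using assms finite_subset by auto
  have "bij_betw (\<lambda>T. A - T) {T. X \<subseteq> T \<and> T \<subseteq> A} (Pow (A - X))"
    using assms(2) by (intro bij_betw_byWitness[where f' = "\<lambda>T. A - T"]) auto
  then have "card {T. X \<subseteq> T \<and> T \<subseteq> A} = 2 ^ card (A - X)"
    using assms(1) by (simp add: bij_betw_same_card card_Pow)
  also have "real \<dots> = (\<Prod>x\<in>X. - 1 + 2) * 2 ^ card (A - X)" by simp
  also have "(\<Prod>x\<in>X. - 1 + 2 :: real) = (\<Sum>F\<in>Pow X. (- 1) ^ card F * 2 ^ card (X - F))"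
    by (subst prod_add[OF finX]) simp
  also have "\<dots> * 2 ^ card (A - X) = (\<Sum>F\<in>Pow X. (- 1) ^ card F * 2 ^ card (A - F))"
    unfolding sum_distrib_right
  proof (rule sum.cong[OF refl])
    fix F assume F: "F \<in> Pow X"
    then have "A - F = (X - F) \<union> (A - X)" using assms(2) by auto
    moreover have "card ((X - F) \<union> (A - X)) = card (X - F) + card (A - X)"
      using assms(1) finX by (intro card_Un_disjoint) auto
    ultimately show "(- 1) ^ card F * 2 ^ card (X - F) * 2 ^ card (A - X) = (- 1 :: real) ^ card F * 2 ^ card (A - F)"
      by (simp add: power_add)
  qed
  finally show ?thesis .
qed

text \<open>
  The sum runs over pairs of a permutation and a set \<open>F\<close> of some of its fixed points. For a given
  \<open>F\<close>, the permutations that fix it are the separating permutations of what remains, and their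
  number is a quotient of factorials.
\<close>

lemma sum_card_fixed_point_supersets:
  assumes "finite A" "S \<subseteq> A"
  shows "(\<Sum>p\<in>separating_perms A S. real (card {T. {i \<in> A. p i = i} \<subseteq> T \<and> T \<subseteq> A})) =
    (\<Sum>F\<in>Pow A. (- 1) ^ card F * 2 ^ card (A - F) * (fact (card (A - F)) / fact (card (S - F))))"
proof -
  have fin: "finite (separating_perms A S)" using assms finite_separating_perms by blast
  have "(\<Sum>p\<in>separating_perms A S. real (card {T. {i \<in> A. p i = i} \<subseteq> T \<and> T \<subseteq> A})) =
     (\<Sum>p\<in>separating_perms A S. \<Sum>F\<in>{F. F \<in> Pow A \<and> (\<forall>i\<in>F. p i = i)}. (- 1) ^ card F * 2 ^ card (A - F))"
    using assms by (intro sum.cong refl, subst card_supersets_within) (auto intro!: sum.cong)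
  also have "\<dots> = (\<Sum>F\<in>Pow A. \<Sum>p\<in>{p. p \<in> separating_perms A S \<and> (\<forall>i\<in>F. p i = i)}. (- 1) ^ card F * 2 ^ card (A - F))"
    using assms by (intro sum.swap_restrict fin) auto
  also have "\<dots> = (\<Sum>F\<in>Pow A. (- 1) ^ card F * 2 ^ card (A - F) * (fact (card (A - F)) / fact (card (S - F))))"
  proof (rule sum.cong[OF refl])
    fix F assume F: "F \<in> Pow A"
    have "card (separating_perms (A - F) (S - F)) * fact (card (S - F)) = fact (card (A - F))"
      using assms by (intro card_separating_perms) auto
    then have "real (card (separating_perms (A - F) (S - F))) * fact (card (S - F)) = fact (card (A - F))"
      by (metis of_nat_fact of_nat_mult)
    then have "real (card (separating_perms (A - F) (S - F))) = fact (card (A - F)) / fact (card (S - F))"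
      by (simp add: field_simps)
    then show "(\<Sum>p\<in>{p. p \<in> separating_perms A S \<and> (\<forall>i\<in>F. p i = i)}. (- 1) ^ card F * 2 ^ card (A - F)) =
      (- 1 :: real) ^ card F * 2 ^ card (A - F) * (fact (card (A - F)) / fact (card (S - F)))"
      using F assms(1) by (simp add: separating_perms_fixing)
  qed
  finally show ?thesis .
qed

lemma sum_Pow_card:
  fixes f :: "nat \<Rightarrow> real"
  assumes "finite X"
  shows "(\<Sum>F\<in>Pow X. f (card F)) = (\<Sum>k\<le>card X. real (card X choose k) * f k)"
proof -
  have "(\<Sum>F\<in>Pow X. f (card F)) = (\<Sum>k\<le>card X. \<Sum>F\<in>{F. F \<in> Pow X \<and> card F = k}. f (card F))"
    using assms by (intro sum.group[symmetric]) (auto intro: card_mono)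
  also have "\<dots> = (\<Sum>k\<le>card X. real (card X choose k) * f k)"
    using n_subsets[OF assms] by (intro sum.cong refl) simp
  finally show ?thesis .
qed

text \<open>
  The summand for \<open>F\<close> depends only on the numbers \<open>j\<close> and \<open>k\<close> of special and of ordinary elements
  in \<open>F\<close>.
\<close>

lemma dB_eq_double_sum:
  "real (dB r n) = (\<Sum>j\<le>r. \<Sum>k\<le>n. real (r choose j) * real (n choose k) * (- 1) ^ (j + k) *
      2 ^ ((r - j) + (n - k)) * (fact ((r - j) + (n - k)) / fact (r - j)))"
proof -
  define A where "A = {1..n + r}"
  define S where "S = {1..r}"
  define B where "B = {r + 1..n + r}"
  have fin: "finite A" "finite S" "finite B" and sub: "S \<subseteq> A" and A: "A = S \<union> B" and disj: "S \<inter> B = {}"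
    and card: "card S = r" "card B = n"
    by (auto simp: A_def S_def B_def)
  let ?w = "\<lambda>F. (- 1) ^ card F * 2 ^ card (A - F) * (fact (card (A - F)) / fact (card (S - F))) :: real"
  let ?h = "\<lambda>j k. (- 1) ^ (j + k) * 2 ^ ((r - j) + (n - k)) * (fact ((r - j) + (n - k)) / fact (r - j)) :: real"
  have "real (dB r n) = (\<Sum>p\<in>separating_perms A S. real (card {T. {i \<in> A. p i = i} \<subseteq> T \<and> T \<subseteq> A}))"
    unfolding dB_def bij_betw_same_card[OF bij_betw_r_derangements_B, symmetric] A_def S_def
    by (subst card_SigmaI) (auto intro: finite_separating_perms)
  also have "\<dots> = (\<Sum>F\<in>Pow A. ?w F)"
    by (rule sum_card_fixed_point_supersets[OF fin(1) sub])
  also have "\<dots> = (\<Sum>(F, G)\<in>Pow S \<times> Pow B. ?h (card F) (card G))"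
  proof (rule sum.reindex_bij_witness[where j = "\<lambda>F. (F \<inter> S, F \<inter> B)" and i = "\<lambda>(F, G). F \<union> G"])
    fix F assume F: "F \<in> Pow A"
    then have finF: "finite F" using fin finite_subset by auto
    have "card F = card (F \<inter> S \<union> F \<inter> B)" using F A by (intro arg_cong[of _ _ card]) auto
    then have cF: "card F = card (F \<inter> S) + card (F \<inter> B)"
      using finF disj by (subst (asm) card_Un_disjoint) auto
    have cS: "card (S - F) = r - card (F \<inter> S)"
      using fin card card_Diff_subset_Int[of S F] by (simp add: Int_commute)
    have cB: "card (B - F) = n - card (F \<inter> B)"
      using fin card card_Diff_subset_Int[of B F] by (simp add: Int_commute)
    have "A - F = (S - F) \<union> (B - F)" using A by auto
    then have "card (A - F) = card (S - F) + card (B - F)"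
      using fin disj by (simp, intro card_Un_disjoint) auto
    then show "(case (F \<inter> S, F \<inter> B) of (F, G) \<Rightarrow> ?h (card F) (card G)) = ?w F"
      using cF cS cB by simp
  qed (use A disj in auto)
  also have "\<dots> = (\<Sum>F\<in>Pow S. \<Sum>G\<in>Pow B. ?h (card F) (card G))"
    by (simp add: sum.cartesian_product)
  also have "\<dots> = (\<Sum>F\<in>Pow S. \<Sum>k\<le>n. real (n choose k) * ?h (card F) k)"
    by (subst sum_Pow_card[OF fin(3)]) (simp add: card)
  also have "\<dots> = (\<Sum>j\<le>r. real (r choose j) * (\<Sum>k\<le>n. real (n choose k) * ?h j k))"
    by (subst sum_Pow_card[OF fin(2), of "\<lambda>j. \<Sum>k\<le>n. real (n choose k) * ?h j k"]) (simp add: card)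
  finally show ?thesis by (simp add: sum_distrib_left mult.assoc)
qed

section \<open>The generating function\<close>

lemma fps_nth_inverse_one_minus_2X_power:
  "fps_nth (inverse ((1 - 2 * fps_X :: real fps) ^ Suc m)) k = 2 ^ k * (fact (m + k) / (fact m * fact k))"
proof -
  have "fps_nth (inverse ((1 - 2 * fps_X :: real fps) ^ Suc m)) k = real ((m + k) choose k) * 2 ^ k"
    using one_minus_const_fps_X_neg_power'[of "Suc m" "2 :: real"]
    by (simp add: numeral_fps_const)
  also have "real ((m + k) choose k) = fact (m + k) / (fact m * fact k)"
    by (simp add: binomial_fact)
  finally show ?thesis by simp
qed

theorem theorem5p4:
  fixes r :: nat
  shows "(Abs_fps (\<lambda>n. of_nat (dB r n) / fact n) :: real fps) =
    fps_exp (- 1) / (1 - 2 * fps_X) * ((1 + 2 * fps_X) / (1 - 2 * fps_X)) ^ r"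
proof -
  \<comment> \<open>Writing \<open>1 + 2x\<close> as \<open>2 - (1 - 2x)\<close> makes the factor of a special element a binomial in \<open>I\<close>,
    so that the \<open>r\<close>-th power has the shape of the outer sum over \<open>j\<close>.\<close>
  define I :: "real fps" where "I = inverse (1 - 2 * fps_X)"
  have I: "I * (1 - 2 * fps_X) = 1"
    unfolding I_def by (rule inverse_mult_eq_1) simp
  have "(1 + 2 * fps_X) / (1 - 2 * fps_X) = (2 - (1 - 2 * fps_X)) * I"
    unfolding I_def by (subst fps_divide_unit) (simp_all add: algebra_simps)
  also have "\<dots> = - 1 + 2 * I"
    using I by (simp add: algebra_simps)
  finally have special: "(1 + 2 * fps_X) / (1 - 2 * fps_X) = - 1 + 2 * I" .
  have "fps_exp (- 1) / (1 - 2 * fps_X) * ((1 + 2 * fps_X) / (1 - 2 * fps_X)) ^ r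
      = fps_exp (- 1) * I * (- 1 + 2 * I) ^ r"
    unfolding special I_def by (subst fps_divide_unit) simp_all
  also have "\<dots> = (\<Sum>j\<le>r. fps_const (real (r choose j) * (- 1) ^ j * 2 ^ (r - j)) * (fps_exp (- 1) * I ^ Suc (r - j)))"
    unfolding binomial_ring sum_distrib_left
    by (intro sum.cong refl)
       (simp add: power_mult_distrib fps_const_mult[symmetric] fps_const_power[symmetric]
          fps_of_nat numeral_fps_const fps_const_neg[symmetric] algebra_simps
          del: fps_const_mult fps_const_power fps_const_neg)
  finally have rhs: "fps_exp (- 1) / (1 - 2 * fps_X) * ((1 + 2 * fps_X) / (1 - 2 * fps_X)) ^ r = \<dots>" .
  have nth_I: "fps_nth (I ^ Suc m) k = 2 ^ k * (fact (m + k) / (fact m * fact k))" for m k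
    unfolding I_def fps_inverse_power[symmetric] by (rule fps_nth_inverse_one_minus_2X_power)
  show ?thesis
  proof (rule fps_ext)
    fix n
    have "fps_nth (fps_const (real (r choose j) * (- 1) ^ j * 2 ^ (r - j)) * (fps_exp (- 1) * I ^ Suc (r - j))) n
       = (\<Sum>k\<le>n. real (r choose j) * real (n choose k) * (- 1) ^ (j + k) *
          2 ^ ((r - j) + (n - k)) * (fact ((r - j) + (n - k)) / fact (r - j))) / fact n" for j
      unfolding fps_mult_left_const_nth fps_mult_nth[of "fps_exp (- 1)"] nth_I sum_distrib_left sum_divide_distrib
        atMost_atLeast0 power_add
      by (intro sum.cong refl) (simp add: binomial_fact mult.commute mult.left_commute)
    then show "fps_nth (Abs_fps (\<lambda>n. of_nat (dB r n) / fact n) :: real fps) n =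
      fps_nth (fps_exp (- 1) / (1 - 2 * fps_X) * ((1 + 2 * fps_X) / (1 - 2 * fps_X)) ^ r) n"
      unfolding rhs fps_sum_nth by (simp add: dB_eq_double_sum sum_divide_distrib)
  qed
qed

end
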